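(* Let $R$ be a commutative ring with identity $1\neq 0$ and let $I$ be a non-zero ideal of $R$. Then the following equivalences hold: (1) $\mathrm{girth}(\overline{\Gamma}(R\Join I))=3$ if and only if $R$ is not an integral domain. (2) $\mathrm{girth}(\overline{\Gamma}(R\Join I))=4$ if and only if $R$ is an integral domain and $|I|\geq 3$. (3) $\mathrm{girth}(\overline{\Gamma}(R\Join I))=\infty$ if and only if $R$ is an integral domain and $|I|=2$.
   Context: For a commutative ring $A$ with $1\neq 0$, $Z(A)$ is the set of zero-divisors of $A$ (including $0$) and $Z(A)^*=Z(A)\setminus\{0\}$. The extended zero-divisor graph $\overline{\Gamma}(A)$ is the simple graph with vertex set $Z(A)^*$ in which distinct vertices $x,y$ are adjacent if and only if there exist integers $n,m\geq 1$ with $x^ny^m=0$, $x^n\neq 0$ and $y^m\neq 0$. The girth of a graph $G$ is the length of a shortest cycle of $G$, and $\infty$ if $G$ has no cycle. For an ideal $I$ of $R$, the amalgamated duplication of $R$ along $I$ is the subring $R\Join I=\{(r,r+i) : r\in R,\ i\in I\}$ of $R\times R$. *)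

theory Defs
  imports
    "HOL-Algebra.Chinese_Remainder"
    "HOL-Algebra.Subrings"
    "HOL-Library.Extended_Nat"
    "Graph_Theory.Pair_Digraph"
begin

definition zero_divisors :: "('a, 'b) ring_scheme \<Rightarrow> 'a set" where
  "zero_divisors A =
     {x \<in> carrier A. \<exists>y \<in> carrier A. y \<noteq> \<zero>\<^bsub>A\<^esub> \<and> x \<otimes>\<^bsub>A\<^esub> y = \<zero>\<^bsub>A\<^esub>}"

lemma (in ring) zero_in_zero_divisors: "\<one> \<noteq> \<zero> \<Longrightarrow> \<zero> \<in> zero_divisors R"
  unfolding zero_divisors_def by auto

text \<open>
  A simple graph is represented as a loop-free symmetric digraph without parallel arcs: an edge
  between \<open>x\<close> and \<open>y\<close> is the pair of arcs \<open>(x, y)\<close> and \<open>(y, x)\<close>.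
\<close>

definition ext_zero_divisor_graph :: "('a, 'b) ring_scheme \<Rightarrow> 'a pair_pre_digraph" where
  "ext_zero_divisor_graph A =
     (let V = zero_divisors A - {\<zero>\<^bsub>A\<^esub>} in
      \<lparr> pverts = V,
        parcs = {(x, y). x \<in> V \<and> y \<in> V \<and> x \<noteq> y \<and>
          (\<exists>(n::nat) (m::nat). n \<ge> 1 \<and> m \<ge> 1 \<and>
             x [^]\<^bsub>A\<^esub> n \<otimes>\<^bsub>A\<^esub> y [^]\<^bsub>A\<^esub> m = \<zero>\<^bsub>A\<^esub> \<and>
             x [^]\<^bsub>A\<^esub> n \<noteq> \<zero>\<^bsub>A\<^esub> \<and> y [^]\<^bsub>A\<^esub> m \<noteq> \<zero>\<^bsub>A\<^esub>)} \<rparr>)"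

lemma (in cring) ext_zero_divisor_graph_bidirected:
  "pair_bidirected_digraph (ext_zero_divisor_graph R)"
proof
  show "symmetric (with_proj (ext_zero_divisor_graph R))"
    unfolding symmetric_def with_proj_simps
  proof (rule symI)
    fix x y assume "(x, y) \<in> parcs (ext_zero_divisor_graph R)"
    then show "(y, x) \<in> parcs (ext_zero_divisor_graph R)"
      unfolding ext_zero_divisor_graph_def Let_def zero_divisors_def
      using m_comm nat_pow_closed by simp metis
  qed
qed (auto simp: ext_zero_divisor_graph_def Let_def)

text \<open>
  In a symmetric digraph the library notion of cycle also admits the closed walks
  \<open>x, y, x\<close> along a single edge, which are not cycles of the simple graph; every other cycle
  has length at least 3. The infimum of the empty set in \<^typ>\<open>enat\<close> is \<open>\<infinity>\<close>.
\<close>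

definition girth :: "'a pair_pre_digraph \<Rightarrow> enat" where
  "girth G = (INF p \<in> {p. pre_digraph.cycle (with_proj G) p \<and> 3 \<le> length p}. enat (length p))"

definition amalgamated_duplication :: "('a, 'b) ring_scheme \<Rightarrow> 'a set \<Rightarrow> ('a \<times> 'a) ring" where
  "amalgamated_duplication R I =
     (RDirProd R R)\<lparr> carrier := {(r, r \<oplus>\<^bsub>R\<^esub> i) | r i. r \<in> carrier R \<and> i \<in> I} \<rparr>"

lemma (in cring) amalgamated_duplication_subring:
  assumes "ideal I R"
  shows "subring {(r, r \<oplus> i) | r i. r \<in> carrier R \<and> i \<in> I} (RDirProd R R)"
proof -
  interpret I: ideal I R by fact
  let ?P = "RDirProd R R"
  interpret P: ring ?P by (rule RDirProd_ring[OF ring_axioms ring_axioms])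
  have ops: "\<one>\<^bsub>?P\<^esub> = (\<one>, \<one>)" "\<zero>\<^bsub>?P\<^esub> = (\<zero>, \<zero>)"
    "\<And>a b c d. (a, b) \<otimes>\<^bsub>?P\<^esub> (c, d) = (a \<otimes> c, b \<otimes> d)"
    "\<And>a b c d. (a, b) \<oplus>\<^bsub>?P\<^esub> (c, d) = (a \<oplus> c, b \<oplus> d)"
    by (simp_all add: RDirProd_def DirProd_def monoid.defs)
  have minus: "\<ominus>\<^bsub>?P\<^esub> (a, b) = (\<ominus> a, \<ominus> b)" if "a \<in> carrier R" "b \<in> carrier R" for a b
    using that by (intro P.minus_equality) (auto simp: ops RDirProd_carrier l_neg)
  have mem: "(a, b) \<in> {(r, r \<oplus> i) | r i. r \<in> carrier R \<and> i \<in> I}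
      \<longleftrightarrow> a \<in> carrier R \<and> b \<in> carrier R \<and> b \<ominus> a \<in> I" for a b
  proof safe
    fix i assume "a \<in> carrier R" "i \<in> I"
    moreover from this have "(a \<oplus> i) \<ominus> a = i" using I.Icarr by algebra
    ultimately show "a \<oplus> i \<in> carrier R" "(a \<oplus> i) \<ominus> a \<in> I" using I.Icarr by auto
  next
    assume "a \<in> carrier R" "b \<in> carrier R" "b \<ominus> a \<in> I"
    moreover from this have "b = a \<oplus> (b \<ominus> a)" by algebra
    ultimately show "\<exists>r i. (a, b) = (r, r \<oplus> i) \<and> r \<in> carrier R \<and> i \<in> I" by blast
  qed
  show ?thesis
  proof (rule P.subringI)
    show "{(r, r \<oplus> i) | r i. r \<in> carrier R \<and> i \<in> I} \<subseteq> carrier ?P"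
      using I.Icarr by (auto simp: RDirProd_carrier)
    show "\<one>\<^bsub>?P\<^esub> \<in> {(r, r \<oplus> i) | r i. r \<in> carrier R \<and> i \<in> I}"
      unfolding ops mem by (simp add: minus_eq r_neg)
  next
    fix h assume "h \<in> {(r, r \<oplus> i) | r i. r \<in> carrier R \<and> i \<in> I}"
    moreover obtain a b where h: "h = (a, b)" by fastforce
    ultimately have ab: "a \<in> carrier R" "b \<in> carrier R" "b \<ominus> a \<in> I" by (simp_all only: mem)
    then have "\<ominus> b \<ominus> (\<ominus> a) = \<ominus> (b \<ominus> a)" by algebra
    with ab show "\<ominus>\<^bsub>?P\<^esub> h \<in> {(r, r \<oplus> i) | r i. r \<in> carrier R \<and> i \<in> I}"
      unfolding h minus[OF ab(1,2)] mem by simp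
  next
    fix h k
    assume "h \<in> {(r, r \<oplus> i) | r i. r \<in> carrier R \<and> i \<in> I}"
      and "k \<in> {(r, r \<oplus> i) | r i. r \<in> carrier R \<and> i \<in> I}"
    moreover obtain a b c d where hk: "h = (a, b)" "k = (c, d)" by fastforce
    ultimately have ab: "a \<in> carrier R" "b \<in> carrier R" "b \<ominus> a \<in> I"
      and cd: "c \<in> carrier R" "d \<in> carrier R" "d \<ominus> c \<in> I" by (simp_all only: mem)
    have "b \<otimes> d \<ominus> a \<otimes> c = b \<otimes> (d \<ominus> c) \<oplus> c \<otimes> (b \<ominus> a)"
      using ab(1,2) cd(1,2) by algebra
    with ab cd show "h \<otimes>\<^bsub>?P\<^esub> k \<in> {(r, r \<oplus> i) | r i. r \<in> carrier R \<and> i \<in> I}"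
      unfolding hk ops mem by (simp add: I.I_l_closed)
    have "b \<oplus> d \<ominus> (a \<oplus> c) = (b \<ominus> a) \<oplus> (d \<ominus> c)"
      using ab(1,2) cd(1,2) by algebra
    with ab cd show "h \<oplus>\<^bsub>?P\<^esub> k \<in> {(r, r \<oplus> i) | r i. r \<in> carrier R \<and> i \<in> I}"
      unfolding hk ops mem by simp
  qed
qed

end

theory Submission
  imports Defs
begin

text \<open>
  If \<open>R\<close> is an integral domain, the vertices of the graph are the pairs \<open>(0, i)\<close> and \<open>(i, 0)\<close> with
  \<open>0 \<noteq> i \<in> I\<close>, and the graph is complete bipartite on these two classes. Otherwise let \<open>a b = 0\<close>
  with \<open>a, b \<noteq> 0\<close>, and let \<open>0 \<noteq> i \<in> I\<close>. Either \<open>i a \<noteq> 0\<close> is annihilated by \<open>b\<close>, or \<open>i\<close> is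
  annihilated by \<open>a\<close>; in both cases some \<open>0 \<noteq> j \<in> I\<close> and \<open>c \<noteq> 0\<close> satisfy \<open>j c = 0\<close>, and
  \<open>(j, 0)\<close>, \<open>(0, j)\<close>, \<open>(c, c)\<close> is a triangle.
\<close>

section \<open>Girth\<close>

lemma girth_ge_3: "3 \<le> girth G"
  unfolding girth_def by (rule INF_greatest) (auto simp: numeral_eq_enat)

lemma girth_le_cycle:
  assumes "pre_digraph.cycle (with_proj G) p" "3 \<le> length p"
  shows "girth G \<le> enat (length p)"
  unfolding girth_def using assms by (intro INF_lower) simp

context pair_wf_digraph
begin

lemma girth_triangle:
  assumes "(x, y) \<in> parcs G" "(y, z) \<in> parcs G" "(z, x) \<in> parcs G"
    and "x \<noteq> y" "y \<noteq> z" "z \<noteq> x"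
  shows "girth G = 3"
proof -
  have "cycle [(x, y), (y, z), (z, x)]"
    using assms unfolding cycle_def
    by (intro exI[of _ x]) (auto simp: awalk_simps wellformed')
  then show ?thesis
    using girth_le_cycle[of G "[(x, y), (y, z), (z, x)]"] girth_ge_3[of G]
    by (simp add: numeral_eq_enat eval_nat_numeral)
qed

lemma girth_le_square:
  assumes "(x, y) \<in> parcs G" "(y, z) \<in> parcs G" "(z, w) \<in> parcs G" "(w, x) \<in> parcs G"
    and "distinct [x, y, z, w]"
  shows "girth G \<le> 4"
proof -
  have "cycle [(x, y), (y, z), (z, w), (w, x)]"
    using assms unfolding cycle_def
    by (intro exI[of _ x]) (auto simp: awalk_simps wellformed')
  then show ?thesis
    using girth_le_cycle[of G "[(x, y), (y, z), (z, w), (w, x)]"]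
    by (simp add: numeral_eq_enat eval_nat_numeral)
qed

text \<open>The map \<open>c\<close> is a proper 2-colouring of the vertices. Its value flips along
  every arc, so no closed walk has length 3: three flips do not return to the starting
  colour.\<close>

lemma bipartite_girth_ge_4:
  assumes "\<And>x y. (x, y) \<in> parcs G \<Longrightarrow> c x \<noteq> (c y :: bool)"
  shows "4 \<le> girth G"
  unfolding girth_def
proof (rule INF_greatest)
  fix p assume "p \<in> {p. cycle p \<and> 3 \<le> length p}"
  then obtain u where u: "awalk u p u" "3 \<le> length p"
    by (auto simp: cycle_def)
  have "length p \<noteq> 3"
  proof
    assume "length p = 3"
    then obtain e f g where "p = [e, f, g]"
      by (auto simp: numeral_3_eq_3 length_Suc_conv)
    with u(1) show False
      using assms[of "fst e" "snd e"] assms[of "fst f" "snd f"] assms[of "fst g" "snd g"]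
      unfolding prod.collapse by (auto simp: awalk_simps)
  qed
  with u(2) show "4 \<le> enat (length p)"
    by (simp add: numeral_eq_enat)
qed

lemma girth_infinity:
  assumes "finite (pverts G)" "card (pverts G) \<le> 2"
  shows "girth G = \<infinity>"
proof -
  have False if p: "cycle p" "3 \<le> length p" for p
  proof -
    from p obtain u where u: "awalk u p u" "distinct (tl (awalk_verts u p))"
      by (auto simp: cycle_def)
    have "set (awalk_verts u p) \<subseteq> pverts G"
      using u(1) by (rule awalkE)
    then have "set (tl (awalk_verts u p)) \<subseteq> pverts G"
      by (cases "awalk_verts u p") auto
    \<comment> \<open>A walk visits one more vertex than it has arcs, so dropping the repeated start
      leaves exactly \<open>length p\<close> distinct vertices.\<close>
    then have "length (tl (awalk_verts u p)) \<le> card (pverts G)"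
      using assms(1) u(2) by (metis card_mono distinct_card)
    then show False
      using assms(2) p(2) by (simp add: length_awalk_verts)
  qed
  then have "{p. cycle p \<and> 3 \<le> length p} = {}" by blast
  then show ?thesis unfolding girth_def by (simp only: image_empty Inf_empty top_enat_def)
qed

end

section \<open>The extended zero-divisor graph of the amalgamated duplication\<close>

lemma (in cring) ext_zero_divisor_graph_arcI:
  assumes "x \<in> carrier R" "y \<in> carrier R" "x \<noteq> \<zero>" "y \<noteq> \<zero>" "x \<noteq> y" "x \<otimes> y = \<zero>"
  shows "(x, y) \<in> parcs (ext_zero_divisor_graph R)"
proof -
  have "x \<in> zero_divisors R" "y \<in> zero_divisors R"
    using assms m_comm[of x y] unfolding zero_divisors_def by auto
  \<comment> \<open>Both exponents are 1: ordinary zero-divisor adjacency is a special case of the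
    extended one.\<close>
  moreover have "\<exists>(n::nat) (m::nat). n \<ge> 1 \<and> m \<ge> 1 \<and>
      x [^] n \<otimes> y [^] m = \<zero> \<and> x [^] n \<noteq> \<zero> \<and> y [^] m \<noteq> \<zero>"
    using assms by (intro exI[of _ 1]) simp
  ultimately show ?thesis
    using assms(3-5) by (simp add: ext_zero_divisor_graph_def)
qed

lemma card_doubleton_le: "card {a, b} \<le> 2"
  by (simp add: card_insert_if)

lemma amalgamated_duplication_simps:
  "carrier (amalgamated_duplication R I) = {(r, r \<oplus>\<^bsub>R\<^esub> i) | r i. r \<in> carrier R \<and> i \<in> I}"
  "\<zero>\<^bsub>amalgamated_duplication R I\<^esub> = (\<zero>\<^bsub>R\<^esub>, \<zero>\<^bsub>R\<^esub>)"
  "\<one>\<^bsub>amalgamated_duplication R I\<^esub> = (\<one>\<^bsub>R\<^esub>, \<one>\<^bsub>R\<^esub>)"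
  "(a, b) \<otimes>\<^bsub>amalgamated_duplication R I\<^esub> (c, d) = (a \<otimes>\<^bsub>R\<^esub> c, b \<otimes>\<^bsub>R\<^esub> d)"
  by (simp_all add: amalgamated_duplication_def RDirProd_def DirProd_def monoid.defs)

lemma amalgamated_duplication_nat_pow:
  "(a, b) [^]\<^bsub>amalgamated_duplication R I\<^esub> (n::nat) = (a [^]\<^bsub>R\<^esub> n, b [^]\<^bsub>R\<^esub> n)"
  by (induction n) (simp_all add: nat_pow_def amalgamated_duplication_simps)

section \<open>The amalgamated duplication as a ring, its axes and its diagonal\<close>

context
  fixes R :: "('a, 'b) ring_scheme" (structure) and I :: "'a set"
  assumes R: "cring R" and I: "ideal I R"
begin

interpretation cring R by (rule R)
interpretation I: ideal I R by (rule I)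

private abbreviation (input) "A \<equiv> amalgamated_duplication R I"

lemma amalgamated_duplication_cring: "cring A"
proof (rule cring.intro)
  interpret P: ring "RDirProd R R" by (rule RDirProd_ring[OF ring_axioms ring_axioms])
  show "ring A"
    unfolding amalgamated_duplication_def
    by (rule P.subring_is_ring[OF amalgamated_duplication_subring[OF I]])
  then interpret A: ring A .
  show "comm_monoid A"
    by (rule A.monoid_comm_monoidI)
      (auto simp: amalgamated_duplication_simps I.Icarr m_comm)
qed

lemma amalgamated_duplication_components:
  "x \<in> carrier A \<Longrightarrow> fst x \<in> carrier R \<and> snd x \<in> carrier R"
  using I.Icarr by (auto simp: amalgamated_duplication_simps)

lemma amalgamated_duplication_diag: "a \<in> carrier R \<Longrightarrow> (a, a) \<in> carrier A"
  by (auto simp: amalgamated_duplication_simps intro!: exI[of _ \<zero>])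

lemma amalgamated_duplication_zero_left: "(\<zero>, b) \<in> carrier A \<longleftrightarrow> b \<in> I"
  using I.Icarr by (force simp: amalgamated_duplication_simps)

lemma amalgamated_duplication_zero_right: "(a, \<zero>) \<in> carrier A \<longleftrightarrow> a \<in> I"
proof
  assume "(a, \<zero>) \<in> carrier A"
  then obtain i where i: "a \<in> carrier R" "i \<in> I" "\<zero> = a \<oplus> i"
    by (auto simp: amalgamated_duplication_simps)
  then have "a = \<ominus> i"
    using I.Icarr minus_equality[of a i] by simp
  then show "a \<in> I" using i(2) by simp
next
  assume "a \<in> I"
  then show "(a, \<zero>) \<in> carrier A"
    \<comment> \<open>The second component is written as \<open>a \<oplus> (\<ominus> a)\<close>,
      and \<open>\<ominus> a\<close> lies in \<open>I\<close> along with \<open>a\<close>.\<close>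
    using I.Icarr by (auto simp: amalgamated_duplication_simps r_neg intro!: exI[of _ "\<ominus> a"])
qed

lemma axes_arc:
  assumes "i \<in> I" "j \<in> I" "i \<noteq> \<zero>" "j \<noteq> \<zero>"
  shows "((i, \<zero>), (\<zero>, j)) \<in> parcs (ext_zero_divisor_graph A)"
    and "((\<zero>, j), (i, \<zero>)) \<in> parcs (ext_zero_divisor_graph A)"
  using assms I.Icarr
  by (auto intro!: cring.ext_zero_divisor_graph_arcI[OF amalgamated_duplication_cring]
      simp: amalgamated_duplication_zero_left amalgamated_duplication_zero_right
        amalgamated_duplication_simps(2,4))

lemma ext_zero_divisor_graph_wf: "pair_wf_digraph (ext_zero_divisor_graph A)"
  using cring.ext_zero_divisor_graph_bidirected[OF amalgamated_duplication_cring]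
  by (simp add: pair_bidirected_digraph_def pair_loopfree_digraph_def)

section \<open>Triangles in the presence of zero-divisors\<close>

lemma triangle_of_annihilator:
  assumes "i \<in> I" "i \<noteq> \<zero>" "c \<in> carrier R" "c \<noteq> \<zero>" "i \<otimes> c = \<zero>"
  shows "girth (ext_zero_divisor_graph A) = 3"
proof (rule pair_wf_digraph.girth_triangle[OF ext_zero_divisor_graph_wf])
  show "((i, \<zero>), (\<zero>, i)) \<in> parcs (ext_zero_divisor_graph A)"
    using assms by (simp add: axes_arc)
  \<comment> \<open>The diagonal element \<open>(c, c)\<close> is annihilated by both axis vertices,
    and differs from them because both its components are nonzero.\<close>
  show "((\<zero>, i), (c, c)) \<in> parcs (ext_zero_divisor_graph A)"
    "((c, c), (i, \<zero>)) \<in> parcs (ext_zero_divisor_graph A)"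
    using assms I.Icarr m_comm[of i c]
    by (auto intro!: cring.ext_zero_divisor_graph_arcI[OF amalgamated_duplication_cring]
        simp: amalgamated_duplication_zero_left amalgamated_duplication_zero_right
          amalgamated_duplication_diag amalgamated_duplication_simps(2,4))
qed (use assms in auto)

private lemma zero_mem: "\<zero> \<in> I"
  by (rule additive_subgroup.zero_closed[OF I.is_additive_subgroup])

lemma girth_not_domain:
  assumes "\<one> \<noteq> \<zero>" "I \<noteq> {\<zero>}" "\<not> domain R"
  shows "girth (ext_zero_divisor_graph A) = 3"
proof -
  obtain i where i: "i \<in> I" "i \<noteq> \<zero>"
    using assms(2) zero_mem by blast
  obtain a b where ab: "a \<in> carrier R" "b \<in> carrier R" "a \<noteq> \<zero>" "b \<noteq> \<zero>" "a \<otimes> b = \<zero>"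
    using assms(1,3) domainI[OF R] by blast
  have ic: "i \<in> carrier R" using i I.Icarr by simp
  consider "i \<otimes> a \<noteq> \<zero>" | "i \<otimes> a = \<zero>" by blast
  then show ?thesis
  proof cases
    case 1
    then show ?thesis
      using triangle_of_annihilator[of "i \<otimes> a" b] i ab ic by (simp add: I.I_r_closed m_assoc)
  next
    case 2
    then show ?thesis
      using triangle_of_annihilator[of i a] i ab by simp
  qed
qed

section \<open>Integral domains: the graph is bipartite\<close>

context
  assumes dom: "domain R"
begin

interpretation domain R by (rule dom)

text \<open>A domain has no nonzero nilpotents, so the exponents in the adjacency relation can be
  stripped off componentwise.\<close>

lemma nat_pow_mult_zero:
  assumes "a \<in> carrier R" "b \<in> carrier R" "a [^] (n::nat) \<otimes> b [^] (m::nat) = \<zero>"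
  shows "a = \<zero> \<or> b = \<zero>"
proof -
  \<comment> \<open>The base case is vacuous, since \<open>c [^] 0\<close> is \<one>, which is
    nonzero in a domain.\<close>
  have *: "c = \<zero>" if "c \<in> carrier R" "c [^] k = \<zero>" for c and k :: nat
    using that by (induction k) (auto simp: integral_iff)
  show ?thesis
    using assms *[of a n] *[of b m] by (auto simp: integral_iff)
qed

text \<open>A nonzero annihilator \<open>(c, d)\<close> of \<open>(a, b)\<close> has a nonzero
  component, and the corresponding component of \<open>(a, b)\<close> must vanish. Hence every
  vertex lies on one of the two axes.\<close>

lemma pverts_domain:
  "pverts (ext_zero_divisor_graph A) \<subseteq>
    {(\<zero>, i) | i. i \<in> I - {\<zero>}} \<union> {(i, \<zero>) | i. i \<in> I - {\<zero>}}"
proof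
  fix x assume x: "x \<in> pverts (ext_zero_divisor_graph A)"
  then obtain y where y: "y \<in> carrier A" "y \<noteq> \<zero>\<^bsub>A\<^esub>" "x \<otimes>\<^bsub>A\<^esub> y = \<zero>\<^bsub>A\<^esub>"
    and x: "x \<in> carrier A" "x \<noteq> \<zero>\<^bsub>A\<^esub>"
    unfolding ext_zero_divisor_graph_def Let_def zero_divisors_def by auto
  obtain a b c d where ab: "x = (a, b)" and "y = (c, d)" by fastforce
  with x y have cd: "(c, d) \<in> carrier A" "(c, d) \<noteq> (\<zero>, \<zero>)" "a \<otimes> c = \<zero>" "b \<otimes> d = \<zero>"
    and xA: "(a, b) \<in> carrier A" "(a, b) \<noteq> (\<zero>, \<zero>)"
    by (simp_all add: amalgamated_duplication_simps(2,4))
  have "a = \<zero> \<or> b = \<zero>"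
    using cd amalgamated_duplication_components[OF cd(1)] amalgamated_duplication_components[OF xA(1)]
    by (auto simp: integral_iff)
  then show "x \<in> {(\<zero>, i) | i. i \<in> I - {\<zero>}} \<union> {(i, \<zero>) | i. i \<in> I - {\<zero>}}"
    using xA ab by (auto simp: amalgamated_duplication_zero_left amalgamated_duplication_zero_right)
qed

text \<open>Being on the axis with vanishing first component is the 2-colouring. Two vertices on the
  same axis are not adjacent, as powers of their nonzero components have a nonzero product.\<close>

lemma parcs_domain:
  assumes "(x, y) \<in> parcs (ext_zero_divisor_graph A)"
  shows "(fst x = \<zero>) \<noteq> (fst y = \<zero>)"
proof -
  have V: "x \<in> pverts (ext_zero_divisor_graph A)" "y \<in> pverts (ext_zero_divisor_graph A)"
    using assms unfolding ext_zero_divisor_graph_def Let_def by auto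
  obtain a b c d where xy: "x = (a, b)" "y = (c, d)" by fastforce
  obtain n m :: nat where "a [^] n \<otimes> c [^] m = \<zero>" "b [^] n \<otimes> d [^] m = \<zero>"
    using assms unfolding xy ext_zero_divisor_graph_def Let_def
    by (auto simp: amalgamated_duplication_simps(2,4) amalgamated_duplication_nat_pow)
  then show ?thesis
    using V[THEN subsetD[OF pverts_domain]] I.Icarr
      nat_pow_mult_zero[of a c n m] nat_pow_mult_zero[of b d n m]
    unfolding xy by auto
qed

lemma girth_domain_ge_4: "4 \<le> girth (ext_zero_divisor_graph A)"
  by (rule pair_wf_digraph.bipartite_girth_ge_4[OF ext_zero_divisor_graph_wf,
        where c = "\<lambda>x. fst x = \<zero>"]) (rule parcs_domain)

lemma girth_domain_eq_4:
  assumes "infinite I \<or> card I \<ge> 3"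
  shows "girth (ext_zero_divisor_graph A) = 4"
proof -
  have "\<not> I \<subseteq> {\<zero>, k}" for k
  proof
    assume "I \<subseteq> {\<zero>, k}"
    then have "finite I" "card I \<le> card {\<zero>, k}"
      by (auto intro: finite_subset card_mono)
    moreover have "card {\<zero>, k} \<le> 2"
      by (rule card_doubleton_le)
    ultimately show False using assms by auto
  qed
  \<comment> \<open>Taking \<open>k\<close> to be \<zero> gives a nonzero \<open>i\<close> in
    \<open>I\<close>; taking \<open>k\<close> to be \<open>i\<close> gives a second nonzero element
    \<open>j\<close>.\<close>
  from this[of \<zero>] this obtain i j where ij: "i \<in> I" "j \<in> I" "i \<noteq> \<zero>" "j \<noteq> \<zero>" "i \<noteq> j"
    by blast
  have "girth (ext_zero_divisor_graph A) \<le> 4"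
    \<comment> \<open>The 4-cycle alternates between the two axes, so each of its edges comes from
      \<open>axes_arc\<close>.\<close>
    by (rule pair_wf_digraph.girth_le_square[OF ext_zero_divisor_graph_wf,
          of "(i, \<zero>)" "(\<zero>, i)" "(j, \<zero>)" "(\<zero>, j)"])
      (use ij axes_arc in auto)
  with girth_domain_ge_4 show ?thesis by (rule antisym[rotated])
qed

lemma girth_domain_infinity:
  assumes "card I = 2"
  shows "girth (ext_zero_divisor_graph A) = \<infinity>"
proof -
  obtain x y where "I = {x, y}"
    using assms by (auto simp: card_2_iff)
  then obtain i where i: "I = {\<zero>, i}"
    using zero_mem by (metis empty_iff insert_commute insert_iff)
  \<comment> \<open>With a single nonzero element in \<open>I\<close>, each axis carries at most one
    vertex, which is too few for a cycle.\<close>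
  have sub: "pverts (ext_zero_divisor_graph A) \<subseteq> {(\<zero>, i), (i, \<zero>)}"
    using pverts_domain i by auto
  have "card (pverts (ext_zero_divisor_graph A)) \<le> card {(\<zero>, i), (i, \<zero>)}"
    using sub by (intro card_mono) auto
  also have "\<dots> \<le> 2" by (rule card_doubleton_le)
  finally have "card (pverts (ext_zero_divisor_graph A)) \<le> 2" .
  moreover have "finite (pverts (ext_zero_divisor_graph A))"
    by (rule finite_subset[OF sub]) simp
  ultimately show ?thesis
    using pair_wf_digraph.girth_infinity[OF ext_zero_divisor_graph_wf] by blast
qed

end

end

theorem corollary3p11:
  fixes R :: "('a, 'b) ring_scheme" and I :: "'a set"
  assumes "cring R" and "\<one>\<^bsub>R\<^esub> \<noteq> \<zero>\<^bsub>R\<^esub>"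
    and "ideal I R" and "I \<noteq> {\<zero>\<^bsub>R\<^esub>}"
  shows "(girth (ext_zero_divisor_graph (amalgamated_duplication R I)) = 3
            \<longleftrightarrow> \<not> domain R) \<and>
         (girth (ext_zero_divisor_graph (amalgamated_duplication R I)) = 4
            \<longleftrightarrow> domain R \<and> (infinite I \<or> card I \<ge> 3)) \<and>
         (girth (ext_zero_divisor_graph (amalgamated_duplication R I)) = \<infinity>
            \<longleftrightarrow> domain R \<and> card I = 2)"
proof (cases "domain R")
  \<comment> \<open>The three conditions on the right exclude one another, as do the values 3, 4 and
    \<infinity>. Computing the girth in each case therefore settles all three equivalences at
    once.\<close>
  case False
  then show ?thesis
    using girth_not_domain[OF assms(1,3,2,4)] by (simp add: numeral_eq_enat)
next
  case True
  interpret cring R by (rule assms)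
  interpret I: ideal I R by (rule assms)
  have zero_mem: "\<zero>\<^bsub>R\<^esub> \<in> I"
    by (rule additive_subgroup.zero_closed[OF I.is_additive_subgroup])
  have "card I \<noteq> 1"
    using assms(4) zero_mem by (metis card_1_singletonE singletonD)
  \<comment> \<open>Since \<open>card\<close> is 0 on infinite sets, the value 0 is excluded for
    finite \<open>I\<close> only; infinite ideals fall under the first alternative below.\<close>
  moreover have "card I \<noteq> 0" if "finite I"
    using that zero_mem by (metis card_0_eq empty_iff)
  ultimately consider "infinite I \<or> card I \<ge> 3" | "card I = 2" by linarith
  then show ?thesis
  proof cases
    case 1
    then show ?thesis
      using girth_domain_eq_4[OF assms(1,3) True 1] True by (auto simp: numeral_eq_enat)
  next
    case 2
    \<comment> \<open>Finiteness refutes the disjunct \<open>infinite I\<close> in the condition for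
      girth 4.\<close>
    then have "finite I" by (intro card_ge_0_finite) simp
    then show ?thesis
      using girth_domain_infinity[OF assms(1,3) True 2] True 2 by (simp add: numeral_eq_enat)
  qed
qed

end
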